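(* Let $\mathbf{l}_x,\mathbf{l}_y\in\mathbb{R}^3$ be nonzero with lengths $l_x,l_y$, let $\mathbf{n}$ be a unit vector with $\mathbf{n}\cdot\mathbf{l}_x=\mathbf{n}\cdot\mathbf{l}_y=0$, and for $\epsilon>0$ put $$\widehat I(\epsilon)=\int_0^1\int_0^1\frac{ds_2\,ds_1}{|\mathbf{l}_xs_1-\mathbf{l}_ys_2+\epsilon\mathbf{n}|}.$$ (i) If $\mathbf{l}_x$ and $\mathbf{l}_y$ are not collinear, then $\widehat I(\epsilon)$ has a finite limit as $\epsilon\to0$, namely $$\lim_{\epsilon\to0}\widehat I(\epsilon)=\widehat I_1(-\mathbf{l}_y,\mathbf{l}_x)+\widehat I_1(\mathbf{l}_x,-\mathbf{l}_y),$$ where $\widehat I_1(\mathbf{a},\mathbf{e})$ is the closed-form expression given in the context. (ii) If $\mathbf{l}_y=\lambda\mathbf{l}_x$ with $\lambda<0$, then $$\lim_{\epsilon\to0}\widehat I(\epsilon)=\frac1{l_y}\ln(1-\lambda)+\frac1{l_x}\ln\frac{1-\lambda}{|\lambda|}.$$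
   Context: This is the "one-touch" case: edges of a source and a receiver triangle emanating from a vertex that becomes common in the limit $\epsilon\to 0$. For non-collinear $\mathbf{a},\mathbf{e}\in\mathbb{R}^3$ let $s_{10}=\frac{\mathbf{a}\cdot\mathbf{e}}{|\mathbf{a}|^2}$, $h_1=|\mathbf{e}-s_{10}\mathbf{a}|>0$, and $$\widehat I_1(\mathbf{a},\mathbf{e})=(1+s_{10})\widehat F_1(|1+s_{10}||\mathbf{a}|)-s_{10}\widehat F_1(|s_{10}||\mathbf{a}|),\qquad \widehat F_1(P)=\frac1P\ln\frac{P+\sqrt{P^2+h_1^2}}{h_1}\quad(P>0),$$ where a term with zero coefficient is omitted. *)

theory Defs
  imports "HOL-Analysis.Analysis"
begin

(* Intended for P > 0 and h > 0. *)
definition F1_hat :: "real \<Rightarrow> real \<Rightarrow> real" where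
  "F1_hat h P = 1 / P * ln ((P + sqrt (P\<^sup>2 + h\<^sup>2)) / h)"

definition s10 :: "real^3 \<Rightarrow> real^3 \<Rightarrow> real" where
  "s10 a e = (a \<bullet> e) / (norm a)\<^sup>2"

definition h1 :: "real^3 \<Rightarrow> real^3 \<Rightarrow> real" where
  "h1 a e = norm (e - s10 a e *\<^sub>R a)"

(* Intended for non-collinear a and e, where h1 a e > 0.  A term whose coefficient
   1 + s10 a e or s10 a e vanishes is meant to be omitted; here it contributes
   0 * F1_hat _ 0 = 0, whatever the value of F1_hat outside its domain P > 0. *)
definition I1_hat :: "real^3 \<Rightarrow> real^3 \<Rightarrow> real" where
  "I1_hat a e =
     (1 + s10 a e) * F1_hat (h1 a e) (\<bar>1 + s10 a e\<bar> * norm a)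
     - s10 a e * F1_hat (h1 a e) (\<bar>s10 a e\<bar> * norm a)"

(* For a unit vector n orthogonal to lx and ly and \<epsilon> > 0 the denominator is at least \<epsilon>,
   so the integrand is continuous and both integrals exist. *)
definition I_hat :: "real^3 \<Rightarrow> real^3 \<Rightarrow> real^3 \<Rightarrow> real \<Rightarrow> real" where
  "I_hat lx ly n \<epsilon> =
     integral {0..1} (\<lambda>s1::real. integral {0..1} (\<lambda>s2::real.
       1 / norm (s1 *\<^sub>R lx - s2 *\<^sub>R ly + \<epsilon> *\<^sub>R n)))"

end

theory Submission
  imports Defs
begin

text \<open>
  Write \<open>R = sqrt (Q(s,t) + e\<^sup>2)\<close> for the denominator, where \<open>Q(s,t)\<close> is the quadratic form
  \<open>|s lx - t ly|\<^sup>2\<close>.  Since \<open>Q\<close> is homogeneous, \<open>H = 1 / (e + R)\<close> satisfies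
  \<open>1 / R = \<partial>\<^sub>s (s H) + \<partial>\<^sub>t (t H)\<close>, so that the double integral over the unit square reduces to the
  integrals of \<open>H\<close> over the two sides \<open>s = 1\<close> and \<open>t = 1\<close>.  There \<open>Q\<close> does not vanish, the
  integrands are jointly continuous down to \<open>e = 0\<close>, and the limits are the elementary integrals of
  \<open>1 / |v + u w|\<close> over \<open>u\<close>.
\<close>

section \<open>The divergence identity for the regularized kernel\<close>

definition reg_norm :: "real \<Rightarrow> real \<Rightarrow> real \<Rightarrow> real \<Rightarrow> real \<Rightarrow> real \<Rightarrow> real" where
  "reg_norm A B C e s t = sqrt (A * s\<^sup>2 + 2 * B * s * t + C * t\<^sup>2 + e\<^sup>2)"

text \<open>The derivative in s of s / (e + R). The form is symmetric under exchanging A with C and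
  s with t, so \<open>flux_deriv C B A e t s\<close> is the derivative in t of t / (e + R), and one
  definition serves both terms of the divergence.\<close>

definition flux_deriv :: "real \<Rightarrow> real \<Rightarrow> real \<Rightarrow> real \<Rightarrow> real \<Rightarrow> real \<Rightarrow> real" where
  "flux_deriv A B C e s t =
     1 / (e + reg_norm A B C e s t)
     - s * (A * s + B * t) / (reg_norm A B C e s t * (e + reg_norm A B C e s t)\<^sup>2)"

lemma reg_norm_commute: "reg_norm A B C e s t = reg_norm C B A e t s"
  by (simp add: reg_norm_def algebra_simps)

lemma reg_norm_pos:
  assumes "e > 0" "A * s\<^sup>2 + 2 * B * s * t + C * t\<^sup>2 \<ge> 0"
  shows "reg_norm A B C e s t > 0"
  using assms by (simp add: reg_norm_def add_nonneg_pos)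

lemma has_derivative_flux:
  assumes "e > 0" "A * s\<^sup>2 + 2 * B * s * t + C * t\<^sup>2 \<ge> 0"
  shows "((\<lambda>s. s / (e + reg_norm A B C e s t)) has_real_derivative flux_deriv A B C e s t)
           (at s within S)"
proof -
  define R where "R = reg_norm A B C e s t"
  have R: "R > 0" unfolding R_def using assms by (rule reg_norm_pos)
  have pos: "A * s\<^sup>2 + 2 * B * s * t + C * t\<^sup>2 + e\<^sup>2 > 0"
    using assms by (simp add: add_nonneg_pos)
  have 1: "((\<lambda>s. reg_norm A B C e s t) has_real_derivative (A * s + B * t) / R) (at s within S)"
    unfolding reg_norm_def R_def using pos
    by (auto intro!: derivative_eq_intros simp: field_simps power2_eq_square)
  have "((\<lambda>s. s / (e + reg_norm A B C e s t)) has_real_derivative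
      (1 * (e + R) - s * (0 + (A * s + B * t) / R)) / ((e + R) * (e + R))) (at s within S)"
    unfolding R_def using R assms
    by (intro DERIV_divide DERIV_add DERIV_ident DERIV_const 1[unfolded R_def])
       (auto simp: R_def)
  moreover have "(1 * (e + R) - s * (0 + (A * s + B * t) / R)) / ((e + R) * (e + R))
      = flux_deriv A B C e s t"
    using R assms(1) unfolding flux_deriv_def R_def[symmetric]
    by (simp add: diff_divide_distrib power2_eq_square)
  ultimately show ?thesis by simp
qed

text \<open>By Euler's identity for a quadratic form, the two subtracted numerators add up to Q =
  R^2 - e^2 = (R - e)(R + e). One factor e + R cancels, and 2/(e + R) - (R - e)/(R (e + R))
  collapses to 1/R.\<close>

lemma flux_divergence:
  assumes "e > 0" "A * s\<^sup>2 + 2 * B * s * t + C * t\<^sup>2 \<ge> 0"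
  shows "1 / reg_norm A B C e s t = flux_deriv A B C e s t + flux_deriv C B A e t s"
proof -
  define R where "R = reg_norm A B C e s t"
  have R: "R > 0" unfolding R_def using assms by (rule reg_norm_pos)
  have "R\<^sup>2 = A * s\<^sup>2 + 2 * B * s * t + C * t\<^sup>2 + e\<^sup>2"
    unfolding R_def reg_norm_def using assms by simp
  then have Q: "s * (A * s + B * t) + t * (C * t + B * s) = (R - e) * (e + R)"
    by (simp add: algebra_simps power2_eq_square)
  have "flux_deriv A B C e s t + flux_deriv C B A e t s
      = 2 / (e + R) - (s * (A * s + B * t) + t * (C * t + B * s)) / (R * (e + R)\<^sup>2)"
    unfolding flux_deriv_def reg_norm_commute[of C B A e t s] R_def[symmetric]
    by (simp add: add_divide_distrib)
  also have "\<dots> = 2 / (e + R) - (R - e) / (R * (e + R))"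
    unfolding Q using R assms(1) by (simp add: power2_eq_square)
  also have "2 / (e + R) = 2 * R / (R * (e + R))"
    using R by simp
  also have "2 * R / (R * (e + R)) - (R - e) / (R * (e + R)) = (2 * R - (R - e)) / (R * (e + R))"
    by (simp only: diff_divide_distrib)
  also have "2 * R - (R - e) = e + R"
    by simp
  also have "(e + R) / (R * (e + R)) = 1 / R"
    using R assms(1) by simp
  finally show ?thesis by (simp add: R_def)
qed

section \<open>Integration over the square reduced to two of its sides\<close>

lemma continuous_on_flux_deriv:
  fixes f g :: "'a::topological_space \<Rightarrow> real"
  assumes "e > 0" "\<And>s t. A * s\<^sup>2 + 2 * B * s * t + C * t\<^sup>2 \<ge> 0"
    and "continuous_on S f" "continuous_on S g"
  shows "continuous_on S (\<lambda>z. flux_deriv A B C e (f z) (g z))"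
proof -
  have R: "reg_norm A B C e s t > 0" for s t
    using assms by (intro reg_norm_pos)
  have c: "continuous_on S (\<lambda>z. reg_norm A B C e (f z) (g z))"
    unfolding reg_norm_def by (intro continuous_intros assms)
  have ne: "reg_norm A B C e s t \<noteq> 0" "e + reg_norm A B C e s t \<noteq> 0" for s t
    using R[of s t] assms(1) by auto
  show ?thesis
    unfolding flux_deriv_def by (intro continuous_intros c assms) (auto simp: ne)
qed

text \<open>The factor s kills the flux at s = 0, so only the side s = 1 contributes.\<close>

lemma integral_flux_deriv:
  assumes "e > 0" "\<And>s t. A * s\<^sup>2 + 2 * B * s * t + C * t\<^sup>2 \<ge> 0"
  shows "integral {0..1} (\<lambda>s. flux_deriv A B C e s t) = 1 / (e + reg_norm A B C e 1 t)"
proof -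
  have "((\<lambda>s. flux_deriv A B C e s t) has_integral
      (1 / (e + reg_norm A B C e 1 t) - 0 / (e + reg_norm A B C e 0 t))) {0..1}"
    using has_derivative_flux[OF assms]
    by (intro fundamental_theorem_of_calculus)
       (auto simp flip: has_real_derivative_iff_has_vector_derivative)
  then show ?thesis by (simp add: integral_unique)
qed

text \<open>The divergence theorem on the unit square: each half of the divergence is integrated
  first in its own variable. For e > 0 everything is continuous, which gives integrability and
  allows a change of order.\<close>

lemma integral_square_inverse_reg_norm:
  assumes e: "e > 0" and Q: "\<And>s t. A * s\<^sup>2 + 2 * B * s * t + C * t\<^sup>2 \<ge> 0"
  shows "integral {0..1} (\<lambda>s. integral {0..1} (\<lambda>t. 1 / reg_norm A B C e s t))
    = integral {0..1} (\<lambda>u. 1 / (e + reg_norm A B C e 1 u))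
      + integral {0..1} (\<lambda>u. 1 / (e + reg_norm A B C e u 1))"
proof -
  have Q': "C * s\<^sup>2 + 2 * B * s * t + A * t\<^sup>2 \<ge> 0" for s t
    using Q[of t s] by (simp add: algebra_simps)
  note cont = continuous_on_flux_deriv[OF e Q] continuous_on_flux_deriv[OF e Q']
  have "integral {0..1} (\<lambda>t. 1 / reg_norm A B C e s t)
      = integral {0..1} (\<lambda>t. flux_deriv A B C e s t) + 1 / (e + reg_norm A B C e s 1)" for s
  proof -
    have "integral {0..1} (\<lambda>t. 1 / reg_norm A B C e s t)
        = integral {0..1} (\<lambda>t. flux_deriv A B C e s t + flux_deriv C B A e t s)"
      by (simp add: flux_divergence[OF e Q])
    also have "\<dots> = integral {0..1} (\<lambda>t. flux_deriv A B C e s t)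
        + integral {0..1} (\<lambda>t. flux_deriv C B A e t s)"
      by (intro integral_add integrable_continuous_real cont continuous_intros)
    also have "integral {0..1} (\<lambda>t. flux_deriv C B A e t s) = 1 / (e + reg_norm A B C e s 1)"
      using integral_flux_deriv[OF e Q'] by (simp add: reg_norm_commute[of A])
    finally show ?thesis .
  qed
  then have "integral {0..1} (\<lambda>s. integral {0..1} (\<lambda>t. 1 / reg_norm A B C e s t))
     = integral {0..1} (\<lambda>s. integral {0..1} (\<lambda>t. flux_deriv A B C e s t)
         + 1 / (e + reg_norm A B C e s 1))"
    by simp
  also have "\<dots> = integral {0..1} (\<lambda>s. integral {0..1} (\<lambda>t. flux_deriv A B C e s t))
      + integral {0..1} (\<lambda>s. 1 / (e + reg_norm A B C e s 1))"
  proof (intro integral_add integrable_continuous_real)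
    have "continuous_on {0..1} (\<lambda>s. integral (cbox 0 1) (\<lambda>t. flux_deriv A B C e s t))"
      by (rule integral_continuous_on_param)
         (auto simp: split_def intro!: cont continuous_intros)
    then show "continuous_on {0..1} (\<lambda>s. integral {0..1} (\<lambda>t. flux_deriv A B C e s t))"
      by simp
    have "e + reg_norm A B C e s 1 \<noteq> 0" for s
      using reg_norm_pos[OF e Q, of s 1] e by simp
    moreover have "continuous_on {0..1} (\<lambda>s. reg_norm A B C e s 1)"
      unfolding reg_norm_def by (intro continuous_intros)
    ultimately show "continuous_on {0..1} (\<lambda>s. 1 / (e + reg_norm A B C e s 1))"
      by (intro continuous_intros) auto
  qed
  \<comment> \<open>The inner integral is in t, but this half is a derivative in s; the order is
    swapped to apply the fundamental theorem.\<close>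
  also have "integral {0..1} (\<lambda>s. integral {0..1} (\<lambda>t. flux_deriv A B C e s t))
      = integral {0..1} (\<lambda>t. integral {0..1} (\<lambda>s. flux_deriv A B C e s t))"
    using integral_swap_continuous[of 0 0 1 1 "flux_deriv A B C e"]
      cont(1)[OF continuous_on_fst[OF continuous_on_id] continuous_on_snd[OF continuous_on_id]]
    by (simp add: split_def)
  also have "\<dots> = integral {0..1} (\<lambda>u. 1 / (e + reg_norm A B C e 1 u))"
    by (simp add: integral_flux_deriv[OF e Q])
  finally show ?thesis .
qed

section \<open>The limit of the integrals over the sides\<close>

lemma norm_add_orthogonal_unit:
  fixes v n :: "'a::real_inner"
  assumes "norm n = 1" "n \<bullet> v = 0"
  shows "norm (v + e *\<^sub>R n) = sqrt ((norm v)\<^sup>2 + e\<^sup>2)"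
proof -
  have "n \<bullet> n = 1" using assms(1) by (simp add: norm_eq_1)
  then have "(norm (v + e *\<^sub>R n))\<^sup>2 = (norm v)\<^sup>2 + e\<^sup>2"
    using assms(2) unfolding power2_norm_eq_inner
    by (simp add: inner_simps inner_commute power2_eq_square)
  then show ?thesis by (metis norm_ge_zero real_sqrt_unique)
qed

lemma I_hat_eq_side_integrals:
  assumes "e > 0" "norm n = 1" "n \<bullet> lx = 0" "n \<bullet> ly = 0"
  shows "I_hat lx ly n e
    = integral {0..1} (\<lambda>u. 1 / (e + sqrt ((norm (lx + u *\<^sub>R - ly))\<^sup>2 + e\<^sup>2)))
      + integral {0..1} (\<lambda>u. 1 / (e + sqrt ((norm (- ly + u *\<^sub>R lx))\<^sup>2 + e\<^sup>2)))"
proof -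
  define A B C where "A = lx \<bullet> lx" and "B = - (lx \<bullet> ly)" and "C = ly \<bullet> ly"
  have Q: "(norm (s *\<^sub>R lx - t *\<^sub>R ly))\<^sup>2 = A * s\<^sup>2 + 2 * B * s * t + C * t\<^sup>2" for s t
    unfolding power2_norm_eq_inner A_def B_def C_def
    by (simp add: inner_simps inner_commute power2_eq_square algebra_simps)
  have Qn: "A * s\<^sup>2 + 2 * B * s * t + C * t\<^sup>2 \<ge> 0" for s t
    unfolding Q[symmetric] by simp
  have R: "sqrt ((norm (s *\<^sub>R lx - t *\<^sub>R ly))\<^sup>2 + e\<^sup>2) = reg_norm A B C e s t" for s t
    by (simp add: reg_norm_def Q)
  have D: "norm (s *\<^sub>R lx - t *\<^sub>R ly + e *\<^sub>R n) = reg_norm A B C e s t" for s t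
    using assms by (subst norm_add_orthogonal_unit) (auto simp: inner_simps R)
  show ?thesis
    unfolding I_hat_def D integral_square_inverse_reg_norm[OF \<open>e > 0\<close> Qn]
    using R[of 1] R[of _ 1] by (simp add: algebra_simps)
qed

text \<open>The segment avoids the origin, so the integrand is jointly continuous for e in the
  closed half-line from 0. The parameter integral is therefore continuous at e = 0, where the
  denominator is just the norm.\<close>

lemma tendsto_regularized_side_integral:
  fixes v w :: "'a::real_inner"
  assumes "\<And>u. u \<in> {0..1} \<Longrightarrow> v + u *\<^sub>R w \<noteq> 0"
  shows "((\<lambda>e. integral {0..1} (\<lambda>u. 1 / (e + sqrt ((norm (v + u *\<^sub>R w))\<^sup>2 + e\<^sup>2))))
    \<longlongrightarrow> integral {0..1} (\<lambda>u. 1 / norm (v + u *\<^sub>R w))) (at_right 0)"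
proof -
  define J where "J e = integral (cbox 0 1) (\<lambda>u. 1 / (e + sqrt ((norm (v + u *\<^sub>R w))\<^sup>2 + e\<^sup>2)))" for e
  have "e + sqrt ((norm (v + u *\<^sub>R w))\<^sup>2 + e\<^sup>2) \<noteq> 0" if "e \<ge> 0" "u \<in> {0..1}" for e u
  proof -
    have "sqrt ((norm (v + u *\<^sub>R w))\<^sup>2 + e\<^sup>2) > 0"
      using assms[OF that(2)] by (simp add: add_pos_nonneg)
    with that show ?thesis by linarith
  qed
  then have "continuous_on {0..} J"
    unfolding J_def
    by (intro integral_continuous_on_param) (auto simp: split_def intro!: continuous_intros)
  then have "(J \<longlongrightarrow> J 0) (at 0 within {0..})"
    by (auto simp: continuous_on_def)
  then have "(J \<longlongrightarrow> J 0) (at_right 0)"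
    by (rule tendsto_within_subset) auto
  then show ?thesis by (simp add: J_def[abs_def])
qed

text \<open>Only the two sides away from the common vertex must miss the origin. This holds for
  non-collinear and for antiparallel edges, so both cases of the theorem rest on this limit.\<close>

lemma tendsto_I_hat:
  assumes n: "norm n = 1" "n \<bullet> lx = 0" "n \<bullet> ly = 0"
    and "\<And>u. u \<in> {0..1} \<Longrightarrow> lx + u *\<^sub>R - ly \<noteq> 0"
    and "\<And>u. u \<in> {0..1} \<Longrightarrow> - ly + u *\<^sub>R lx \<noteq> 0"
  shows "(I_hat lx ly n \<longlongrightarrow> integral {0..1} (\<lambda>u. 1 / norm (lx + u *\<^sub>R - ly))
           + integral {0..1} (\<lambda>u. 1 / norm (- ly + u *\<^sub>R lx))) (at_right 0)"
proof -
  \<comment> \<open>The reduction to side integrals is available for e > 0 only.\<close>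
  have ev: "\<forall>\<^sub>F e in at_right 0. e > (0::real)"
    by (simp add: eventually_at_right_less)
  show ?thesis
    by (rule Lim_transform_eventually
        [OF tendsto_add[OF tendsto_regularized_side_integral tendsto_regularized_side_integral]])
       (use assms ev in \<open>auto simp: I_hat_eq_side_integrals elim!: eventually_mono\<close>)
qed

section \<open>Closed forms of the side integrals\<close>

lemma F1_hat_eq_arsinh:
  assumes "h > 0"
  shows "F1_hat h P = arsinh (P / h) / P"
proof -
  have "sqrt ((P / h)\<^sup>2 + 1) = sqrt ((P\<^sup>2 + h\<^sup>2) / h\<^sup>2)"
    using assms by (simp add: power_divide add_divide_distrib)
  also have "\<dots> = sqrt (P\<^sup>2 + h\<^sup>2) / h"
    using assms by (simp add: real_sqrt_divide)
  finally show ?thesis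
    by (simp add: F1_hat_def arsinh_real_def add_divide_distrib)
qed

text \<open>Since arsinh is odd, the absolute value disappears. For c = 0 both sides are 0, which
  matches the omitted term in the closed form.\<close>

lemma mult_F1_hat_abs:
  assumes "h > 0" "p > 0"
  shows "c * F1_hat h (\<bar>c\<bar> * p) = arsinh (c * p / h) / p"
  using assms by (cases "c \<ge> 0") (auto simp: F1_hat_eq_arsinh abs_if)

text \<open>The point e - c a of the line is its closest point to the origin, at distance h.
  Pythagoras gives |e + u a|^2 = ((u + c) p)^2 + h^2, with antiderivative arsinh ((u + c) p / h) / p
  of the inverse norm; the ends u = 1 and u = 0 produce the coefficients 1 + c and c.\<close>

lemma integral_inverse_norm_eq_I1_hat:
  assumes "\<not> collinear {0, a, e}"
  shows "integral {0..1} (\<lambda>u. 1 / norm (e + u *\<^sub>R a)) = I1_hat a e"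
proof -
  define c h p where "c = s10 a e" and "h = h1 a e" and "p = norm a"
  have p: "p > 0" using assms by (auto simp: p_def collinear_lemma)
  have h: "h > 0" using assms by (auto simp: h_def h1_def collinear_lemma)
  have ae: "a \<bullet> e = c * p\<^sup>2" using p by (simp add: c_def s10_def p_def)
  have hsq: "h\<^sup>2 = e \<bullet> e - c\<^sup>2 * p\<^sup>2"
    using ae unfolding h_def h1_def p_def power2_norm_eq_inner c_def[symmetric]
    by (simp add: inner_simps inner_commute power2_eq_square algebra_simps)
  have N: "norm (e + u *\<^sub>R a) = h * sqrt (((u + c) * p / h)\<^sup>2 + 1)" for u
  proof -
    have "(norm (e + u *\<^sub>R a))\<^sup>2 = e \<bullet> e + 2 * u * (a \<bullet> e) + u\<^sup>2 * p\<^sup>2"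
      unfolding p_def power2_norm_eq_inner
      by (simp add: inner_simps inner_commute power2_eq_square algebra_simps)
    also have "\<dots> = ((u + c) * p)\<^sup>2 + h\<^sup>2"
      unfolding ae hsq by (simp add: power2_eq_square algebra_simps)
    also have "\<dots> = (h * sqrt (((u + c) * p / h)\<^sup>2 + 1))\<^sup>2"
      using h by (simp add: power_mult_distrib power_divide field_simps)
    finally show ?thesis using h by (simp add: power2_eq_iff_nonneg)
  qed
  have "((\<lambda>u. 1 / norm (e + u *\<^sub>R a)) has_integral
      (arsinh ((1 + c) * p / h) / p - arsinh ((0 + c) * p / h) / p)) {0..1}"
  proof (rule fundamental_theorem_of_calculus)
    fix u :: real
    have "((\<lambda>u. (u + c) * p / h) has_real_derivative p / h) (at u within {0..1})"
      using h by (auto intro!: derivative_eq_intros)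
    from DERIV_cdivide[OF DERIV_chain2[OF arsinh_real_has_field_derivative this], of p]
    have "((\<lambda>u. arsinh ((u + c) * p / h) / p) has_real_derivative 1 / norm (e + u *\<^sub>R a))
        (at u within {0..1})"
      using p h by (simp add: N mult.commute)
    then show "((\<lambda>u. arsinh ((u + c) * p / h) / p) has_vector_derivative 1 / norm (e + u *\<^sub>R a))
        (at u within {0..1})"
      by (simp add: has_real_derivative_iff_has_vector_derivative)
  qed simp
  then show ?thesis
    unfolding I1_hat_def c_def[symmetric] h_def[symmetric] p_def[symmetric]
      mult_F1_hat_abs[OF h p]
    by (simp add: integral_unique)
qed

text \<open>For antiparallel edges the norm along a side is d = |lx| times a positive affine
  function of u, so the integral is a logarithm.\<close>

lemma integral_inverse_linear:
  fixes b c d :: real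
  assumes "b > 0" "c > 0" "d > 0"
  shows "integral {0..1} (\<lambda>u. 1 / (d * (c + u * b))) = ln ((c + b) / c) / (d * b)"
proof -
  have "((\<lambda>u. 1 / (d * (c + u * b))) has_integral
      (ln (c + 1 * b) / (d * b) - ln (c + 0 * b) / (d * b))) {0..1}"
  proof (rule fundamental_theorem_of_calculus)
    fix u :: real assume "u \<in> {0..1}"
    then have "c + u * b > 0" using assms by (simp add: add_pos_nonneg)
    then have "((\<lambda>u. ln (c + u * b)) has_real_derivative b / (c + u * b)) (at u within {0..1})"
      by (auto intro!: derivative_eq_intros)
    from DERIV_cdivide[OF this, of "d * b"]
    show "((\<lambda>u. ln (c + u * b) / (d * b)) has_vector_derivative 1 / (d * (c + u * b)))
        (at u within {0..1})"
      using assms unfolding has_real_derivative_iff_has_vector_derivative[symmetric]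
      by (simp add: mult.commute)
  qed simp
  then show ?thesis
    using assms by (simp add: integral_unique ln_div diff_divide_distrib)
qed

theorem mainTheorem7:
  fixes lx ly n :: "real^3"
  assumes "lx \<noteq> 0" and "ly \<noteq> 0"
    and "norm n = 1" and "n \<bullet> lx = 0" and "n \<bullet> ly = 0"
  shows "(\<not> collinear {0, lx, ly} \<longrightarrow>
            (I_hat lx ly n \<longlongrightarrow> I1_hat (- ly) lx + I1_hat lx (- ly)) (at_right 0))
       \<and> (\<forall>l::real. l < 0 \<and> ly = l *\<^sub>R lx \<longrightarrow>
            (I_hat lx ly n \<longlongrightarrow>
               1 / norm ly * ln (1 - l) + 1 / norm lx * ln ((1 - l) / \<bar>l\<bar>)) (at_right 0))"
proof (intro conjI impI allI)
  assume nc: "\<not> collinear {0, lx, ly}"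
  \<comment> \<open>The closed form is applied with (a, e) = (lx, -ly) through \<open>nc1\<close>
    and with (-ly, lx) through \<open>nc2\<close>.\<close>
  then have nc1: "\<not> collinear {0, lx, - ly}"
    using collinear_scaleR_iff[of 1 lx "-1" ly] by simp
  then have nc2: "\<not> collinear {0, - ly, lx}"
    by (simp add: insert_commute)
  have "lx + u *\<^sub>R - ly \<noteq> 0" for u
    using nc2 unfolding collinear_lemma by (metis add.commute add_eq_0_iff scaleR_minus_left)
  moreover have "- ly + u *\<^sub>R lx \<noteq> 0" for u
    using nc1 unfolding collinear_lemma by (metis add.commute add_eq_0_iff scaleR_minus_left)
  ultimately show "(I_hat lx ly n \<longlongrightarrow> I1_hat (- ly) lx + I1_hat lx (- ly)) (at_right 0)"
    using tendsto_I_hat[OF assms(3-5)]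
    unfolding integral_inverse_norm_eq_I1_hat[OF nc1] integral_inverse_norm_eq_I1_hat[OF nc2]
    by blast
next
  fix l :: real
  assume l: "l < 0 \<and> ly = l *\<^sub>R lx"
  \<comment> \<open>With ly = -m lx and m > 0 the two terms of lx - u ly, and of -ly + u lx, point
    the same way and cannot cancel; a positive ratio l would put the origin on one of these
    sides.\<close>
  define m p where "m = - l" and "p = norm lx"
  have m: "m > 0" and p: "p > 0" and l_eq: "l = - m" and ly: "ly = - m *\<^sub>R lx"
    using l assms(1) by (auto simp: m_def p_def)
  have v1: "lx + u *\<^sub>R - ly = (1 + u * m) *\<^sub>R lx" for u
    by (simp add: ly algebra_simps)
  have v2: "- ly + u *\<^sub>R lx = (m + u * 1) *\<^sub>R lx" for u
    by (simp add: ly algebra_simps)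
  have pos: "1 + u * m > 0" "m + u * 1 > 0" if "u \<in> {0..1}" for u
    using that m by (auto simp: add_pos_nonneg)
  have "lx + u *\<^sub>R - ly \<noteq> 0" "- ly + u *\<^sub>R lx \<noteq> 0" if "u \<in> {0..1}" for u
    unfolding v1 v2 using pos[OF that] assms(1) by auto
  note lim = tendsto_I_hat[OF assms(3-5) this]
  have "integral {0..1} (\<lambda>u. 1 / norm (lx + u *\<^sub>R - ly))
      = integral {0..1} (\<lambda>u. 1 / (p * (1 + u * m)))"
    unfolding v1 using pos(1) by (intro integral_cong) (simp add: p_def abs_of_pos)
  \<comment> \<open>Here p m = |ly| and 1 + m = 1 - l.\<close>
  also have "\<dots> = 1 / norm ly * ln (1 - l)"
    using integral_inverse_linear[OF m zero_less_one p] m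
    by (simp add: ly l_eq p_def mult.commute)
  finally have 1: "integral {0..1} (\<lambda>u. 1 / norm (lx + u *\<^sub>R - ly))
      = 1 / norm ly * ln (1 - l)" .
  have "integral {0..1} (\<lambda>u. 1 / norm (- ly + u *\<^sub>R lx))
      = integral {0..1} (\<lambda>u. 1 / (p * (m + u * 1)))"
    unfolding v2 using pos(2) by (intro integral_cong) (simp add: p_def abs_of_pos)
  also have "\<dots> = 1 / norm lx * ln ((1 - l) / \<bar>l\<bar>)"
    using integral_inverse_linear[OF zero_less_one m p] m
    by (simp add: l_eq p_def add.commute)
  finally show "(I_hat lx ly n \<longlongrightarrow>
      1 / norm ly * ln (1 - l) + 1 / norm lx * ln ((1 - l) / \<bar>l\<bar>)) (at_right 0)"
    using lim unfolding 1 by simp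
qed

end
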